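(* Let $\{p(x|\theta)\}_{\theta\in\Theta}$ be a family of distributions on an outcome space $\mathcal{X}$, let $\{p(\theta|\nu,n):\nu\in\mathbb{R}^k,n\in\mathbb{R}_+\}$ be a conjugate prior family for it with statistic $\phi:\mathcal{X}\to\mathbb{R}^k$, let the common prior be $p(\theta|\nu_0,n_0)$, and let there be $m\ge 2$ agents. Then there exists a (single-sample) mechanism $S:\mathcal{R}\times\mathcal{X}\to\mathbb{R}$, for some report space $\mathcal{R}$, achieving optimal aggregation if and only if for all $(\nu,n)$ and $(\nu',n')$ reachable from $(\nu_0,n_0)$, the equality of posterior predictive distributions $p(x|\nu,n)=p(x|\nu',n')$ implies $(\nu,n)\equiv(\nu',n')$.
   Context: Setting. $\mathcal{X}$ is an outcome space (discrete or continuous, distributions being given by mass functions or densities), $\Delta_{\mathcal{X}}$ is the set of distributions on $\mathcal{X}$, and $\{p(x|\theta)\}_{\theta\in\Theta}\subseteq\Delta_{\mathcal{X}}$. A parameter $\theta^*$ is drawn from the common-knowledge prior $p(\theta)$. There are $m$ agents. Agent $i$ privately observes a finite (possibly empty) multiset $X^i$ of samples from $\mathcal{X}$. All samples (including the principal's) are drawn independently from $p(x|\theta^* )$ given $\theta^*$. The number of samples of each agent is not known to the principal. Conjugate prior. A family $\{p(\theta|\nu,n):\nu\in\mathbb{R}^k,n\in\mathbb{R}_+\}\subseteq\Delta_\Theta$ is a conjugate prior family for $\{p(x|\theta)\}$ if there is a statistic $\phi:\mathcal{X}\to\mathbb{R}^k$ such that for all $\nu_0,n_0$ and $x$ the posterior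 after observing $x$, $$p(\theta|\nu_0,n_0,x)=\frac{p(\theta|\nu_0,n_0)\,p(x|\theta)}{\int_\Theta p(\theta'|\nu_0,n_0)\,p(x|\theta')\,d\theta'},$$ equals $p(\theta|\nu_0+\phi(x),n_0+1)$. Posterior predictive distribution (PPD). $p(x|\nu,n)=\int_\Theta p(x|\theta)\,p(\theta|\nu,n)\,d\theta\in\Delta_{\mathcal{X}}$. For a finite multiset $X$ of elements of $\mathcal{X}$, $p(x|\nu,n,X)$ is the PPD after updating on $X$, i.e. $p(x|\nu,n,X)=p\bigl(x\,\big|\,\nu+\sum_{y\in X}\phi(y),\,n+|X|\bigr)$ (sum with multiplicity). An agent observing $X^i$ has belief $p(x|\nu_0,n_0,X^i)$ about the principal's sample. The global PPD is $p(x|\nu_0,n_0,X)$ where $X=\uplus_i X^i$ (multiset sum). Optimal aggregation. A mechanism is a report space $\mathcal{R}$ together with a score $S:\mathcal{R}\times\mathcal{X}\to\mathbb{R}$. The principal has one sample $x$ and pays agent $i$ the amount $S(r_i,x)$. Agent $i$ with samples $X^i$ reports $r_i=\operatorname{argmax}_{r\in\mathcal{R}}\mathbb{E}_{x\sim p(x|\nu_0,n_0,X^i)}[S(r,x)]$ (the maximizer being required to exist and be unique). $S$ achieves optimal aggregation if there is a function $g:\mathcal{R}^m\to\Delta_{\mathcal{X}}$ such that, for all finite multisets $X^1,\dots,X^m$ of elements of $\mathcal{X}$, with $X=\uplus_i X^i$, one has $g(r_1,\dots,r_m)=p(x|\nu_0,n_0,X)$. The function $g$ may depend on the prior and on the family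 of distributions, which are known to the principal. Reachability and equivalence. $(\nu,n)$ is reachable from $(\nu_0,n_0)$ if there is a finite multiset $X$ of elements of $\mathcal{X}$ with $\nu=\nu_0+\sum_{x\in X}\phi(x)$ and $n=n_0+|X|$. We write $(\nu,n)\equiv(\nu',n')$ if for all finite multisets $X$ of elements of $\mathcal{X}$, including $\emptyset$, $p(x|\nu,n,X)=p(x|\nu',n',X)$ as distributions on $\mathcal{X}$. *)

theory Defs
  imports "HOL-Probability.Probability"
begin

text \<open>
  \<open>M\<close> and \<open>T\<close> are the reference measures on the outcome space and on the parameter space
  (counting measure in the discrete case, e.g. Lebesgue measure in the continuous case).
  Distributions are given by densities \<open>p \<theta> x\<close> for \<open>p(x|\<theta>)\<close> and \<open>q \<nu> n \<theta>\<close> for \<open>p(\<theta>|\<nu>,n)\<close>.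
\<close>

definition prob_density :: "'a measure \<Rightarrow> ('a \<Rightarrow> real) \<Rightarrow> bool" where
  "prob_density N f \<longleftrightarrow>
     f \<in> borel_measurable N \<and> (\<forall>x\<in>space N. 0 \<le> f x) \<and> (\<integral>\<^sup>+x. ennreal (f x) \<partial>N) = 1"

definition distributions :: "'a measure \<Rightarrow> 'a measure set" where
  "distributions N = {density N (\<lambda>x. ennreal (f x)) | f. prob_density N f}"

text \<open>Joint measurability makes the mixtures over \<open>\<theta>\<close> below well defined; it is automatic
  from measurability in \<open>\<theta>\<close> when the outcome space is countable and discrete.\<close>

definition distribution_family ::
    "'x measure \<Rightarrow> 't measure \<Rightarrow> ('t \<Rightarrow> 'x \<Rightarrow> real) \<Rightarrow> bool" where
  "distribution_family M T p \<longleftrightarrow>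
     sigma_finite_measure M \<and> sigma_finite_measure T \<and>
     (\<lambda>(\<theta>, x). p \<theta> x) \<in> borel_measurable (T \<Otimes>\<^sub>M M) \<and>
     (\<forall>\<theta>\<in>space T. prob_density M (p \<theta>))"

definition posterior ::
    "'t measure \<Rightarrow> ('t \<Rightarrow> 'x \<Rightarrow> real) \<Rightarrow> ('t \<Rightarrow> real) \<Rightarrow> 'x \<Rightarrow> 't \<Rightarrow> real" where
  "posterior T p prior x \<theta> = prior \<theta> * p \<theta> x / (\<integral>\<theta>'. prior \<theta>' * p \<theta>' x \<partial>T)"

text \<open>The posterior given \<open>x\<close> is only defined if the normalising integral exists and is
  nonzero. The Bochner integral is 0 for non-integrable functions, so one inequality covers both.
  The parameter \<open>n\<close> ranges over the positive reals.\<close>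

definition conjugate_prior_family ::
    "'x measure \<Rightarrow> 't measure \<Rightarrow> ('t \<Rightarrow> 'x \<Rightarrow> real) \<Rightarrow>
     (real ^ 'k \<Rightarrow> real \<Rightarrow> 't \<Rightarrow> real) \<Rightarrow> ('x \<Rightarrow> real ^ 'k) \<Rightarrow> bool" where
  "conjugate_prior_family M T p q \<phi> \<longleftrightarrow>
     (\<forall>\<nu> n. n > 0 \<longrightarrow> prob_density T (q \<nu> n)) \<and>
     (\<forall>\<nu> n. n > 0 \<longrightarrow> (\<forall>x\<in>space M. (\<integral>\<theta>. q \<nu> n \<theta> * p \<theta> x \<partial>T) \<noteq> 0 \<longrightarrow>
        (AE \<theta> in T. posterior T p (q \<nu> n) x \<theta> = q (\<nu> + \<phi> x) (n + 1) \<theta>)))"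

definition ppd ::
    "'x measure \<Rightarrow> 't measure \<Rightarrow> ('t \<Rightarrow> 'x \<Rightarrow> real) \<Rightarrow>
     (real ^ 'k \<Rightarrow> real \<Rightarrow> 't \<Rightarrow> real) \<Rightarrow> real ^ 'k \<Rightarrow> real \<Rightarrow> 'x measure" where
  "ppd M T p q \<nu> n = density M (\<lambda>x. ennreal (\<integral>\<theta>. p \<theta> x * q \<nu> n \<theta> \<partial>T))"

definition updated_ppd ::
    "'x measure \<Rightarrow> 't measure \<Rightarrow> ('t \<Rightarrow> 'x \<Rightarrow> real) \<Rightarrow>
     (real ^ 'k \<Rightarrow> real \<Rightarrow> 't \<Rightarrow> real) \<Rightarrow> ('x \<Rightarrow> real ^ 'k) \<Rightarrow>
     real ^ 'k \<Rightarrow> real \<Rightarrow> 'x multiset \<Rightarrow> 'x measure" where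
  "updated_ppd M T p q \<phi> \<nu> n X =
     ppd M T p q (\<nu> + (\<Sum>y\<in>#X. \<phi> y)) (n + real (size X))"

definition reachable ::
    "'x measure \<Rightarrow> ('x \<Rightarrow> real ^ 'k) \<Rightarrow> real ^ 'k \<Rightarrow> real \<Rightarrow> real ^ 'k \<Rightarrow> real \<Rightarrow> bool" where
  "reachable M \<phi> \<nu>0 n0 \<nu> n \<longleftrightarrow>
     (\<exists>X. set_mset X \<subseteq> space M \<and> \<nu> = \<nu>0 + (\<Sum>x\<in>#X. \<phi> x) \<and> n = n0 + real (size X))"

definition ppd_equivalent ::
    "'x measure \<Rightarrow> 't measure \<Rightarrow> ('t \<Rightarrow> 'x \<Rightarrow> real) \<Rightarrow>
     (real ^ 'k \<Rightarrow> real \<Rightarrow> 't \<Rightarrow> real) \<Rightarrow> ('x \<Rightarrow> real ^ 'k) \<Rightarrow>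
     real ^ 'k \<Rightarrow> real \<Rightarrow> real ^ 'k \<Rightarrow> real \<Rightarrow> bool" where
  "ppd_equivalent M T p q \<phi> \<nu> n \<nu>' n' \<longleftrightarrow>
     (\<forall>X. set_mset X \<subseteq> space M \<longrightarrow>
        updated_ppd M T p q \<phi> \<nu> n X = updated_ppd M T p q \<phi> \<nu>' n' X)"

definition expected_score :: "('r \<Rightarrow> 'x \<Rightarrow> real) \<Rightarrow> 'x measure \<Rightarrow> 'r \<Rightarrow> real" where
  "expected_score S Q r = (\<integral>x. S r x \<partial>Q)"

definition best_report :: "'r set \<Rightarrow> ('r \<Rightarrow> 'x \<Rightarrow> real) \<Rightarrow> 'x measure \<Rightarrow> 'r" where
  "best_report R S Q = arg_max (expected_score S Q) (\<lambda>r. r \<in> R)"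

text \<open>\<open>belief X\<close> is the predictive distribution held after observing the samples \<open>X\<close>.
  Integrability makes every expected score meaningful. The report space \<open>R\<close> is a set in an
  arbitrary type. HOL cannot quantify over types inside a formula, so a claim that some report
  space exists names a type (\<open>'x measure\<close>) and is paired with the claim that a mechanism with
  reports in any type \<open>'r\<close> yields one with reports in that type.\<close>

definition optimal_aggregation ::
    "'x measure \<Rightarrow> ('x multiset \<Rightarrow> 'x measure) \<Rightarrow> nat \<Rightarrow> 'r set \<Rightarrow> ('r \<Rightarrow> 'x \<Rightarrow> real) \<Rightarrow> bool" where
  "optimal_aggregation M belief m R S \<longleftrightarrow>
     (\<forall>X. set_mset X \<subseteq> space M \<longrightarrow>
        (\<forall>r\<in>R. integrable (belief X) (S r)) \<and>
        (\<exists>!r. is_arg_max (expected_score S (belief X)) (\<lambda>r. r \<in> R) r)) \<and>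
     (\<exists>g \<in> ({..<m} \<rightarrow>\<^sub>E R) \<rightarrow> distributions M.
        \<forall>Xs :: nat \<Rightarrow> 'x multiset. (\<forall>i<m. set_mset (Xs i) \<subseteq> space M) \<longrightarrow>
          g (\<lambda>i\<in>{..<m}. best_report R S (belief (Xs i))) = belief (\<Sum>i<m. Xs i))"

end

theory Submission
  imports Defs
begin

text \<open>
  Compatibility of the predictive distribution with adding samples is exactly what a mechanism
  needs. If two data sets give the same predictive distribution, they induce the same report, so
  adding a second agent's data to either must give the same aggregate. Conversely, if the
  predictive distribution of each agent can be elicited, the agents' data sets can be exchanged
  one at a time for arbitrary data sets that lead to the same reports.

  Elicitation needs a strictly proper scoring rule with integrable scores on all densities at once.
  After passing to an equivalent finite reference measure \<open>N\<close>, the supergradient of the strictly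
  convex functional \<open>f \<mapsto> \<integral> sqrt (1 + f\<^sup>2) dN\<close> is bounded, which gives such a rule.
\<close>

subsection \<open>A bounded strictly proper scoring rule\<close>

text \<open>With \<open>h t = sqrt (1 + t^2)\<close>, the first term is the slope
  \<open>h' (f x)\<close>. The second integrates \<open>h t - t * h' t = 1 / sqrt (1 + t^2)\<close>,
  the height at 0 of the tangent at \<open>t = f y\<close>. The expected score is thus the tangent
  functional of the integral of \<open>h\<close> at \<open>f\<close>.\<close>

definition hyperbolic_score :: "'a measure \<Rightarrow> ('a \<Rightarrow> real) \<Rightarrow> 'a \<Rightarrow> real" where
  "hyperbolic_score N f x = f x / sqrt (1 + (f x)\<^sup>2) + (\<integral>y. 1 / sqrt (1 + (f y)\<^sup>2) \<partial>N)"

text \<open>The left side is the tangent to \<open>sqrt (1 + t^2)\<close> at \<open>a\<close>,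
  evaluated at \<open>b\<close>. The bound is Cauchy-Schwarz for \<open>(a, 1)\<close> and
  \<open>(b, 1)\<close>; Lagrange's identity shows the defect to be \<open>(a - b)^2\<close>, which
  settles equality.\<close>

lemma hyperbolic_tangent_le:
  fixes a b :: real
  shows "(a * b + 1) / sqrt (1 + a\<^sup>2) \<le> sqrt (1 + b\<^sup>2)"
    and "(a * b + 1) / sqrt (1 + a\<^sup>2) = sqrt (1 + b\<^sup>2) \<Longrightarrow> a = b"
proof -
  have pos: "sqrt (1 + a\<^sup>2) > 0"
    by (simp add: add_pos_nonneg)
  have lagrange: "(1 + a\<^sup>2) * (1 + b\<^sup>2) = (a * b + 1)\<^sup>2 + (a - b)\<^sup>2"
    by (simp add: power2_eq_square algebra_simps)
  have "a * b + 1 \<le> sqrt ((1 + a\<^sup>2) * (1 + b\<^sup>2))"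
    by (rule real_le_rsqrt) (simp add: lagrange)
  with pos show "(a * b + 1) / sqrt (1 + a\<^sup>2) \<le> sqrt (1 + b\<^sup>2)"
    by (simp add: pos_divide_le_eq real_sqrt_mult mult.commute)
  assume "(a * b + 1) / sqrt (1 + a\<^sup>2) = sqrt (1 + b\<^sup>2)"
  with pos have "a * b + 1 = sqrt ((1 + a\<^sup>2) * (1 + b\<^sup>2))"
    by (simp add: divide_eq_eq real_sqrt_mult mult.commute)
  then have "(a * b + 1)\<^sup>2 = (1 + a\<^sup>2) * (1 + b\<^sup>2)"
    by simp
  with lagrange show "a = b"
    by simp
qed

lemma prob_density_integrable:
  assumes "prob_density N f"
  shows "integrable N f" and "(\<integral>x. f x \<partial>N) = 1"
proof -
  have f: "f \<in> borel_measurable N" "AE x in N. 0 \<le> f x" "(\<integral>\<^sup>+x. ennreal (f x) \<partial>N) = ennreal 1"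
    using assms by (auto simp: prob_density_def)
  show "integrable N f"
    using f by (intro integrableI_nn_integral_finite[where x = 1])
  show "(\<integral>x. f x \<partial>N) = 1"
    using f by (subst integral_eq_nn_integral) auto
qed

context finite_measure
begin

text \<open>Reduces an expected score to an integral of pointwise tangent values. The slope is
  bounded by 1, so weighting it by \<open>g\<close> keeps it integrable; the intercept is bounded
  and \<open>M\<close> is finite; and the constant part of the score survives unchanged because
  \<open>g\<close> has mass 1.\<close>

lemma hyperbolic_score_expectation:
  assumes f [measurable]: "f \<in> borel_measurable M" and g: "prob_density M g"
  defines "Q \<equiv> density M (\<lambda>x. ennreal (g x))"
  shows "integrable Q (hyperbolic_score M f)"
    and "integrable M (\<lambda>x. (f x * g x + 1) / sqrt (1 + (f x)\<^sup>2))"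
    and "(\<integral>x. hyperbolic_score M f x \<partial>Q) = (\<integral>x. (f x * g x + 1) / sqrt (1 + (f x)\<^sup>2) \<partial>M)"
proof -
  have [measurable]: "g \<in> borel_measurable M" and nonneg: "AE x in M. 0 \<le> g x"
    using g by (auto simp: prob_density_def)
  note int_g = prob_density_integrable[OF g]
  have slope: "integrable M (\<lambda>x. g x * (f x / sqrt (1 + (f x)\<^sup>2)))"
  proof (rule Bochner_Integration.integrable_bound[OF int_g(1)])
    have "\<bar>f x / sqrt (1 + (f x)\<^sup>2)\<bar> \<le> 1" for x
      by (simp add: abs_divide divide_le_eq add_pos_nonneg real_le_rsqrt)
    then show "AE x in M. norm (g x * (f x / sqrt (1 + (f x)\<^sup>2))) \<le> norm (g x)"
      unfolding real_norm_def abs_mult by (intro AE_I2 mult_left_le) auto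
  qed measurable
  have const: "integrable M (\<lambda>x. 1 / sqrt (1 + (f x)\<^sup>2))"
    by (rule integrable_const_bound[where B = 1]) (auto simp: divide_le_eq add_pos_nonneg)
  have split: "(\<lambda>x. (f x * g x + 1) / sqrt (1 + (f x)\<^sup>2)) =
      (\<lambda>x. g x * (f x / sqrt (1 + (f x)\<^sup>2)) + 1 / sqrt (1 + (f x)\<^sup>2))"
    by (simp add: add_divide_distrib mult.commute)
  show "integrable M (\<lambda>x. (f x * g x + 1) / sqrt (1 + (f x)\<^sup>2))"
    unfolding split using slope const by simp
  let ?c = "\<integral>y. 1 / sqrt (1 + (f y)\<^sup>2) \<partial>M"
  have scaled: "(\<lambda>x. g x *\<^sub>R hyperbolic_score M f x) =
      (\<lambda>x. g x * (f x / sqrt (1 + (f x)\<^sup>2)) + g x * ?c)"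
    by (simp add: hyperbolic_score_def algebra_simps)
  have [measurable]: "hyperbolic_score M f \<in> borel_measurable M"
    unfolding hyperbolic_score_def by measurable
  show "integrable Q (hyperbolic_score M f)"
    unfolding Q_def using nonneg slope int_g(1) by (simp add: integrable_density scaled del: real_scaleR_def)
  have "(\<integral>x. hyperbolic_score M f x \<partial>Q) = (\<integral>x. g x * (f x / sqrt (1 + (f x)\<^sup>2)) + g x * ?c \<partial>M)"
    unfolding Q_def using nonneg by (simp add: integral_density scaled del: real_scaleR_def)
  also have "\<dots> = (\<integral>x. g x * (f x / sqrt (1 + (f x)\<^sup>2)) \<partial>M) + ?c"
    using slope int_g by simp
  also have "\<dots> = (\<integral>x. (f x * g x + 1) / sqrt (1 + (f x)\<^sup>2) \<partial>M)"
    unfolding split using slope const by simp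
  finally show "(\<integral>x. hyperbolic_score M f x \<partial>Q) = (\<integral>x. (f x * g x + 1) / sqrt (1 + (f x)\<^sup>2) \<partial>M)" .
qed

text \<open>The pointwise tangent inequality is integrated. In case of equality the gap is
  nonnegative with integral 0, hence vanishes almost everywhere, so that \<open>f\<close> and
  \<open>g\<close> define the same measure.\<close>

lemma hyperbolic_score_strictly_proper:
  assumes f [measurable]: "f \<in> borel_measurable M" and g: "prob_density M g"
  defines "Q \<equiv> density M (\<lambda>x. ennreal (g x))"
  shows "(\<integral>x. hyperbolic_score M f x \<partial>Q) \<le> (\<integral>x. hyperbolic_score M g x \<partial>Q)"
    and "(\<integral>x. hyperbolic_score M f x \<partial>Q) = (\<integral>x. hyperbolic_score M g x \<partial>Q) \<Longrightarrow>
      density M (\<lambda>x. ennreal (f x)) = Q"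
proof -
  have g_meas [measurable]: "g \<in> borel_measurable M"
    using g by (simp add: prob_density_def)
  note exp_f = hyperbolic_score_expectation[OF f g, folded Q_def]
  note exp_g = hyperbolic_score_expectation[OF g_meas g, folded Q_def]
  have diag: "(\<lambda>x. (g x * g x + 1) / sqrt (1 + (g x)\<^sup>2)) = (\<lambda>x. sqrt (1 + (g x)\<^sup>2))"
    by (simp add: real_div_sqrt power2_eq_square add.commute)
  show "(\<integral>x. hyperbolic_score M f x \<partial>Q) \<le> (\<integral>x. hyperbolic_score M g x \<partial>Q)"
    unfolding exp_f(3) exp_g(3)
    using exp_f(2) exp_g(2) by (rule integral_mono) (simp add: diag[THEN fun_cong] hyperbolic_tangent_le(1))
  let ?gap = "\<lambda>x. sqrt (1 + (g x)\<^sup>2) - (f x * g x + 1) / sqrt (1 + (f x)\<^sup>2)"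
  assume "(\<integral>x. hyperbolic_score M f x \<partial>Q) = (\<integral>x. hyperbolic_score M g x \<partial>Q)"
  then have "(\<integral>x. ?gap x \<partial>M) = 0"
    using exp_f exp_g by (simp add: diag)
  moreover have "integrable M ?gap"
    using exp_f(2) exp_g(2) by (simp add: diag)
  ultimately have "AE x in M. ?gap x = 0"
    by (subst (asm) integral_nonneg_eq_0_iff_AE) (auto simp: hyperbolic_tangent_le(1))
  then have "AE x in M. f x = g x"
    by eventually_elim (rule hyperbolic_tangent_le(2), simp)
  then show "density M (\<lambda>x. ennreal (f x)) = Q"
    unfolding Q_def by (intro density_cong) auto
qed

end

text \<open>Weighting \<open>M\<close> by a strictly positive integrable \<open>w\<close> gives a
  finite measure; a density \<open>f\<close> for \<open>M\<close> becomes \<open>f / w\<close> for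
  the new measure without changing the distribution.\<close>

lemma (in sigma_finite_measure) obtain_finite_reference:
  obtains N where "finite_measure N" and "distributions M \<subseteq> distributions N"
proof -
  obtain w :: "'a \<Rightarrow> real" where w [measurable]: "w \<in> borel_measurable M"
    and pos: "\<And>x. w x > 0" and int: "integrable M w"
    by (rule obtain_positive_integrable_function) blast
  define N where "N = density M (\<lambda>x. ennreal (w x))"
  have "emeasure N (space N) = (\<integral>\<^sup>+x. ennreal (w x) \<partial>M)"
    by (simp add: N_def emeasure_density cong: nn_integral_cong)
  also have "\<dots> \<noteq> \<infinity>"
    using int pos by (simp add: nn_integral_eq_integral less_imp_le)
  finally have "finite_measure N"
    by (rule finite_measureI)
  moreover have "distributions M \<subseteq> distributions N"
  proof
    fix Q assume "Q \<in> distributions M"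
    then obtain f where f: "prob_density M f" and Q: "Q = density M (\<lambda>x. ennreal (f x))"
      by (auto simp: distributions_def)
    have [measurable]: "f \<in> borel_measurable M" and nonneg: "x \<in> space M \<Longrightarrow> 0 \<le> f x" for x
      using f by (auto simp: prob_density_def)
    have cancel: "ennreal (w x) * ennreal (f x / w x) = ennreal (f x)" if "x \<in> space M" for x
      using nonneg[OF that] pos[of x] by (simp flip: ennreal_mult)
    have "prob_density N (\<lambda>x. f x / w x)"
      using f pos unfolding prob_density_def N_def
      by (auto simp: nn_integral_density cancel less_imp_le cong: nn_integral_cong)
    moreover have "Q = density N (\<lambda>x. ennreal (f x / w x))"
      unfolding Q N_def by (subst density_density_eq) (auto simp: cancel intro!: density_cong)
    ultimately show "Q \<in> distributions N"
      by (auto simp: distributions_def)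
  qed
  ultimately show thesis ..
qed

lemma (in sigma_finite_measure) ex_strictly_proper_score:
  obtains S :: "'a measure \<Rightarrow> 'a \<Rightarrow> real" where
    "\<And>P Q. P \<in> distributions M \<Longrightarrow> Q \<in> distributions M \<Longrightarrow> integrable Q (S P)"
    "\<And>P Q. P \<in> distributions M \<Longrightarrow> Q \<in> distributions M \<Longrightarrow>
      expected_score S Q P \<le> expected_score S Q Q"
    "\<And>P Q. P \<in> distributions M \<Longrightarrow> Q \<in> distributions M \<Longrightarrow>
      expected_score S Q P = expected_score S Q Q \<Longrightarrow> P = Q"
proof -
  obtain N where "finite_measure N" and sub: "distributions M \<subseteq> distributions N"
    by (rule obtain_finite_reference)
  interpret N: finite_measure N by fact
  have "\<forall>Q\<in>distributions N. \<exists>f. prob_density N f \<and> Q = density N (\<lambda>x. ennreal (f x))"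
    by (auto simp: distributions_def)
  \<comment> \<open>Reports are measures but the score acts on densities, so \<open>d\<close> fixes
    one version of each density. The choice is harmless: the conclusion of strict propriety is an
    equality of measures.\<close>
  then obtain d where d: "\<And>Q. Q \<in> distributions N \<Longrightarrow> prob_density N (d Q)"
    and d_eq: "\<And>Q. Q \<in> distributions N \<Longrightarrow> density N (\<lambda>x. ennreal (d Q x)) = Q"
    by metis
  have meas: "d Q \<in> borel_measurable N" if "Q \<in> distributions N" for Q
    using d[OF that] by (simp add: prob_density_def)
  show thesis
  proof (rule that[of "\<lambda>P. hyperbolic_score N (d P)"], unfold expected_score_def)
    fix P Q assume "P \<in> distributions M" "Q \<in> distributions M"
    then have P: "P \<in> distributions N" and Q: "Q \<in> distributions N"
      using sub by auto
    show "integrable Q (hyperbolic_score N (d P))"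
      using N.hyperbolic_score_expectation(1)[OF meas[OF P] d[OF Q]] by (simp add: d_eq Q)
    show "(\<integral>x. hyperbolic_score N (d P) x \<partial>Q) \<le> (\<integral>x. hyperbolic_score N (d Q) x \<partial>Q)"
      using N.hyperbolic_score_strictly_proper(1)[OF meas[OF P] d[OF Q]] by (simp add: d_eq Q)
    show "P = Q"
      if "(\<integral>x. hyperbolic_score N (d P) x \<partial>Q) = (\<integral>x. hyperbolic_score N (d Q) x \<partial>Q)"
      using N.hyperbolic_score_strictly_proper(2)[OF meas[OF P] d[OF Q]] that
      by (simp add: d_eq P Q)
  qed
qed

subsection \<open>Mechanisms and compatibility with multiset sums\<close>

text \<open>The kernel of \<open>b\<close> is a congruence for the sum of multisets over
  \<open>A\<close>.\<close>

definition sum_compatible :: "'x set \<Rightarrow> ('x multiset \<Rightarrow> 'b) \<Rightarrow> bool" where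
  "sum_compatible A b \<longleftrightarrow>
     (\<forall>X Y Z. set_mset X \<subseteq> A \<longrightarrow> set_mset Y \<subseteq> A \<longrightarrow> set_mset Z \<subseteq> A \<longrightarrow>
        b X = b Y \<longrightarrow> b (X + Z) = b (Y + Z))"

lemma set_mset_sum: "finite I \<Longrightarrow> set_mset (\<Sum>i\<in>I. F i) = (\<Union>i\<in>I. set_mset (F i))"
  by (induction I rule: finite_induct) auto

lemma sum_compatible_sum:
  fixes m :: nat
  assumes b: "sum_compatible A b"
    and XY: "\<And>i. i < m \<Longrightarrow> set_mset (X i) \<subseteq> A \<and> set_mset (Y i) \<subseteq> A \<and> b (X i) = b (Y i)"
  shows "b (\<Sum>i<m. X i) = b (\<Sum>i<m. Y i)"
proof -
  \<comment> \<open>The context \<open>Z\<close> is arbitrary so that it can absorb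
    \<open>Y k\<close> once \<open>X k\<close> has been replaced; the induction hypothesis then
    exchanges the remaining summands.\<close>
  have "b ((\<Sum>i<k. X i) + Z) = b ((\<Sum>i<k. Y i) + Z)" if "k \<le> m" "set_mset Z \<subseteq> A" for k Z
    using that
  proof (induction k arbitrary: Z)
    case (Suc k)
    have sub: "set_mset (\<Sum>i<k. X i) \<subseteq> A"
      using Suc.prems(1) XY by (simp add: set_mset_sum UN_subset_iff)
    have k: "set_mset (X k) \<subseteq> A" "set_mset (Y k) \<subseteq> A" "b (X k) = b (Y k)"
      using XY[of k] Suc.prems by auto
    have "b (X k + ((\<Sum>i<k. X i) + Z)) = b (Y k + ((\<Sum>i<k. X i) + Z))"
      using b k sub Suc.prems unfolding sum_compatible_def by (metis Un_least set_mset_union)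
    moreover have "b ((\<Sum>i<k. X i) + (Y k + Z)) = b ((\<Sum>i<k. Y i) + (Y k + Z))"
      using Suc k by (intro Suc.IH) auto
    ultimately show ?case
      by (simp add: ac_simps)
  qed simp
  from this[of m "{#}"] show ?thesis
    by simp
qed

lemma optimal_aggregation_imp_sum_compatible:
  assumes "optimal_aggregation M belief m R S" and "m \<ge> 2"
  shows "sum_compatible (space M) belief"
  unfolding sum_compatible_def
proof (intro allI impI)
  fix X Y Z :: "'a multiset"
  assume sub: "set_mset X \<subseteq> space M" "set_mset Y \<subseteq> space M" "set_mset Z \<subseteq> space M"
    and eq: "belief X = belief Y"
  from assms obtain g where g: "\<And>Xs. (\<forall>i<m. set_mset (Xs i) \<subseteq> space M) \<Longrightarrow>
      g (\<lambda>i\<in>{..<m}. best_report R S (belief (Xs i))) = belief (\<Sum>i<m. Xs i)"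
    unfolding optimal_aggregation_def by blast
  \<comment> \<open>Agent 0 holds the data to be varied, agent 1 the added data \<open>Z\<close>,
    all others nothing. Having \<open>m \<ge> 2\<close> makes room for both.\<close>
  let ?D = "\<lambda>W i. if i = 0 then W else if i = 1 then Z else {#}"
  have total: "(\<Sum>i<m. ?D W i) = W + Z" for W
  proof -
    have "(\<Sum>i<m. ?D W i) = (\<Sum>i\<in>{0, 1 :: nat}. ?D W i)"
      using assms(2) by (intro sum.mono_neutral_right) auto
    then show ?thesis by simp
  qed
  have aggregate: "belief (W + Z) = g (\<lambda>i\<in>{..<m}. best_report R S (belief (?D W i)))"
    if "set_mset W \<subseteq> space M" for W
    using g[of "?D W"] that sub by (simp add: total)
  \<comment> \<open>A report depends on the data only through the belief, so the principal cannot
    tell \<open>X\<close> from \<open>Y\<close>.\<close>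
  have "(\<lambda>i\<in>{..<m}. best_report R S (belief (?D X i))) =
      (\<lambda>i\<in>{..<m}. best_report R S (belief (?D Y i)))"
    using eq by auto
  then show "belief (X + Z) = belief (Y + Z)"
    by (simp only: aggregate[OF sub(1)] aggregate[OF sub(2)])
qed

lemma (in sigma_finite_measure) sum_compatible_imp_optimal_aggregation:
  assumes belief: "\<And>X. set_mset X \<subseteq> space M \<Longrightarrow> belief X \<in> distributions M"
    and compat: "sum_compatible (space M) belief"
  shows "\<exists>(R :: 'a measure set) S. optimal_aggregation M belief m R S"
proof -
  obtain S :: "'a measure \<Rightarrow> 'a \<Rightarrow> real" where
    int: "\<And>P Q. P \<in> distributions M \<Longrightarrow> Q \<in> distributions M \<Longrightarrow> integrable Q (S P)"
    and le: "\<And>P Q. P \<in> distributions M \<Longrightarrow> Q \<in> distributions M \<Longrightarrow>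
      expected_score S Q P \<le> expected_score S Q Q"
    and strict: "\<And>P Q. P \<in> distributions M \<Longrightarrow> Q \<in> distributions M \<Longrightarrow>
      expected_score S Q P = expected_score S Q Q \<Longrightarrow> P = Q"
    by (rule ex_strictly_proper_score) blast
  let ?R = "distributions M"
  let ?valid = "\<lambda>Xs. \<forall>i<m. set_mset (Xs i) \<subseteq> space M"
  \<comment> \<open>Strict propriety makes the truthful report the unique maximizer, so the choice
    operator in \<open>best_report\<close> must return the belief itself.\<close>
  have arg_max: "is_arg_max (expected_score S Q) (\<lambda>r. r \<in> ?R) P \<longleftrightarrow> P = Q" if "Q \<in> ?R" for P Q
    unfolding is_arg_max_linorder using that le strict by (metis antisym)
  have best: "best_report ?R S Q = Q" if "Q \<in> ?R" for Q
    unfolding best_report_def arg_max_def arg_max[OF that] by simp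
  define reports where "reports Xs = (\<lambda>i\<in>{..<m}. belief (Xs i))" for Xs :: "nat \<Rightarrow> 'a multiset"
  \<comment> \<open>For each report profile that can occur, \<open>data\<close> selects some data
    sets explaining it, in general not the true ones.\<close>
  have "\<forall>r. \<exists>D. (\<exists>Xs. ?valid Xs \<and> reports Xs = r) \<longrightarrow> ?valid D \<and> reports D = r"
    by blast
  from choice[OF this] obtain data where data: "\<And>Xs. ?valid Xs \<Longrightarrow>
      ?valid (data (reports Xs)) \<and> reports (data (reports Xs)) = reports Xs"
    by blast
  \<comment> \<open>Profiles that no data produce get the prior belief, merely to keep
    \<open>g\<close> inside the distributions.\<close>
  define g where "g r = (if \<exists>Xs. ?valid Xs \<and> reports Xs = r then belief (\<Sum>i<m. data r i)
    else belief {#})" for r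
  have "g \<in> ({..<m} \<rightarrow>\<^sub>E ?R) \<rightarrow> ?R"
  proof
    fix r
    show "g r \<in> ?R"
    proof (cases "\<exists>Xs. ?valid Xs \<and> reports Xs = r")
      case True
      then have "?valid (data r)"
        using data by blast
      then have "set_mset (\<Sum>i<m. data r i) \<subseteq> space M"
        by (simp add: set_mset_sum UN_subset_iff)
      with True show ?thesis
        by (simp add: g_def belief)
    next
      case False
      then show ?thesis
        unfolding g_def by (subst if_not_P) (auto intro: belief)
    qed
  qed
  moreover have "g (\<lambda>i\<in>{..<m}. best_report ?R S (belief (Xs i))) = belief (\<Sum>i<m. Xs i)"
    if "?valid Xs" for Xs
  proof -
    have "(\<lambda>i\<in>{..<m}. best_report ?R S (belief (Xs i))) = reports Xs"
      using that by (auto simp: reports_def best belief)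
    \<comment> \<open>The selected data agree with the true data only in each agent's belief;
      compatibility lifts this to the pooled data.\<close>
    moreover have "belief (data (reports Xs) i) = belief (Xs i)" if "i < m" for i
      using data[OF \<open>?valid Xs\<close>] that unfolding reports_def by (metis lessThan_iff restrict_apply')
    then have "belief (\<Sum>i<m. data (reports Xs) i) = belief (\<Sum>i<m. Xs i)"
      using data[OF that] that by (intro sum_compatible_sum[OF compat]) auto
    moreover have "\<exists>Ys. ?valid Ys \<and> reports Ys = reports Xs"
      using that by blast
    ultimately show ?thesis
      by (simp add: g_def)
  qed
  ultimately have "optimal_aggregation M belief m ?R S"
    unfolding optimal_aggregation_def using int belief by (auto simp: arg_max)
  then show ?thesis by blast
qed

subsection \<open>Posterior predictive distributions\<close>

text \<open>Tonelli gives the mixture mass 1 when it is computed with nonnegative integrals. The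
  density itself is a Bochner integral, so the two must be matched almost everywhere.\<close>

lemma mixture_in_distributions:
  assumes fam: "distribution_family M T p" and w: "prob_density T w"
  shows "density M (\<lambda>x. ennreal (\<integral>\<theta>. p \<theta> x * w \<theta> \<partial>T)) \<in> distributions M"
proof -
  interpret M: sigma_finite_measure M using fam by (simp add: distribution_family_def)
  interpret T: sigma_finite_measure T using fam by (simp add: distribution_family_def)
  interpret pair_sigma_finite T M ..
  have p_meas [measurable]: "(\<lambda>(\<theta>, x). p \<theta> x) \<in> borel_measurable (T \<Otimes>\<^sub>M M)"
    and p: "\<And>\<theta>. \<theta> \<in> space T \<Longrightarrow> prob_density M (p \<theta>)"
    using fam by (auto simp: distribution_family_def)
  have w_meas [measurable]: "w \<in> borel_measurable T" and w_nn: "\<And>\<theta>. \<theta> \<in> space T \<Longrightarrow> 0 \<le> w \<theta>"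
    and w_int: "(\<integral>\<^sup>+\<theta>. ennreal (w \<theta>) \<partial>T) = 1"
    using w by (auto simp: prob_density_def)
  let ?k = "\<lambda>\<theta> x. p \<theta> x * w \<theta>"
  have k_nn: "0 \<le> ?k \<theta> x" if "\<theta> \<in> space T" "x \<in> space M" for \<theta> x
    using p[OF that(1)] w_nn that by (simp add: prob_density_def)
  have k_meas [measurable]: "(\<lambda>(\<theta>, x). ?k \<theta> x) \<in> borel_measurable (T \<Otimes>\<^sub>M M)"
    by measurable
  have "(\<integral>\<^sup>+x. ennreal (?k \<theta> x) \<partial>M) = ennreal (w \<theta>)" if "\<theta> \<in> space T" for \<theta>
  proof -
    have "(\<integral>\<^sup>+x. ennreal (?k \<theta> x) \<partial>M) = (\<integral>\<^sup>+x. ennreal (p \<theta> x) * ennreal (w \<theta>) \<partial>M)"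
      using w_nn[OF that] by (simp add: ennreal_mult'')
    also have "\<dots> = ennreal (w \<theta>)"
      using p[OF that] by (subst nn_integral_multc) (auto simp: prob_density_def)
    finally show ?thesis .
  qed
  then have "(\<integral>\<^sup>+\<theta>. \<integral>\<^sup>+x. ennreal (?k \<theta> x) \<partial>M \<partial>T) = 1"
    using w_int by (simp cong: nn_integral_cong)
  then have total: "(\<integral>\<^sup>+x. \<integral>\<^sup>+\<theta>. ennreal (?k \<theta> x) \<partial>T \<partial>M) = 1"
    by (subst Fubini') auto
  then have "AE x in M. (\<integral>\<^sup>+\<theta>. ennreal (?k \<theta> x) \<partial>T) \<noteq> \<infinity>"
    by (intro nn_integral_PInf_AE) auto
  \<comment> \<open>Where the mixture density is infinite the Bochner integral is 0, but only on a null set.\<close>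
  then have fin: "AE x in M. ennreal (\<integral>\<theta>. ?k \<theta> x \<partial>T) = (\<integral>\<^sup>+\<theta>. ennreal (?k \<theta> x) \<partial>T)"
    using AE_space
  proof eventually_elim
    case (elim x)
    have "(\<lambda>\<theta>. ?k \<theta> x) \<in> borel_measurable T"
      using measurable_compose[OF measurable_Pair2'[OF elim(2)] k_meas] by simp
    then have "integrable T (\<lambda>\<theta>. ?k \<theta> x)"
      using elim k_nn by (intro integrableI_nonneg) (auto simp: less_top)
    then show ?case
      using elim k_nn by (subst nn_integral_eq_integral) auto
  qed
  have "prob_density M (\<lambda>x. \<integral>\<theta>. ?k \<theta> x \<partial>T)"
    unfolding prob_density_def
  proof (intro conjI ballI)
    show "(\<lambda>x. \<integral>\<theta>. ?k \<theta> x \<partial>T) \<in> borel_measurable M"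
      by measurable
    show "0 \<le> (\<integral>\<theta>. ?k \<theta> x \<partial>T)" if "x \<in> space M" for x
      using k_nn[OF _ that] by (intro Bochner_Integration.integral_nonneg) auto
    show "(\<integral>\<^sup>+x. ennreal (\<integral>\<theta>. ?k \<theta> x \<partial>T) \<partial>M) = 1"
      using total fin by (subst nn_integral_cong_AE[OF fin]) simp
  qed
  then show ?thesis
    by (auto simp: distributions_def)
qed

lemma updated_ppd_add:
  fixes \<nu> :: "real ^ 'k"
  shows "updated_ppd M T p q \<phi> (\<nu> + (\<Sum>y\<in>#X. \<phi> y)) (n + real (size X)) Z =
    updated_ppd M T p q \<phi> \<nu> n (X + Z)"
  by (simp add: updated_ppd_def add.assoc)

text \<open>A reachable pair is the prior's parameters shifted by some data set, and updating it
  further on \<open>Z\<close> equals updating the prior on the sum, by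
  \<open>updated_ppd_add\<close>. Both sides thus speak of the same triples \<open>X\<close>,
  \<open>Y\<close>, \<open>Z\<close>.\<close>

lemma sum_compatible_updated_ppd_iff:
  fixes M :: "'a measure" and \<nu>0 :: "real ^ 'k"
  shows "sum_compatible (space M) (updated_ppd M T p q \<phi> \<nu>0 n0) \<longleftrightarrow>
     (\<forall>\<nu> n \<nu>' n'.
        reachable M \<phi> \<nu>0 n0 \<nu> n \<longrightarrow> reachable M \<phi> \<nu>0 n0 \<nu>' n' \<longrightarrow>
        ppd M T p q \<nu> n = ppd M T p q \<nu>' n' \<longrightarrow>
        ppd_equivalent M T p q \<phi> \<nu> n \<nu>' n')"
  (is "?L \<longleftrightarrow> ?R")
proof
  assume L: ?L
  show ?R
    unfolding reachable_def ppd_equivalent_def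
  proof (clarify, unfold updated_ppd_add)
    fix X Y Z :: "'a multiset"
    assume "set_mset X \<subseteq> space M" "set_mset Y \<subseteq> space M" "set_mset Z \<subseteq> space M"
      and "ppd M T p q (\<nu>0 + (\<Sum>y\<in>#X. \<phi> y)) (n0 + real (size X)) =
        ppd M T p q (\<nu>0 + (\<Sum>y\<in>#Y. \<phi> y)) (n0 + real (size Y))"
    with L show "updated_ppd M T p q \<phi> \<nu>0 n0 (X + Z) = updated_ppd M T p q \<phi> \<nu>0 n0 (Y + Z)"
      unfolding sum_compatible_def updated_ppd_def[of M T p q \<phi> \<nu>0 n0, symmetric] by blast
  qed
next
  assume R: ?R
  show ?L
    unfolding sum_compatible_def
  proof (intro allI impI)
    fix X Y Z assume sub: "set_mset X \<subseteq> space M" "set_mset Y \<subseteq> space M" "set_mset Z \<subseteq> space M"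
      and eq: "updated_ppd M T p q \<phi> \<nu>0 n0 X = updated_ppd M T p q \<phi> \<nu>0 n0 Y"
    have "ppd_equivalent M T p q \<phi> (\<nu>0 + (\<Sum>y\<in>#X. \<phi> y)) (n0 + real (size X))
        (\<nu>0 + (\<Sum>y\<in>#Y. \<phi> y)) (n0 + real (size Y))"
      using R sub eq unfolding reachable_def updated_ppd_def by blast
    then show "updated_ppd M T p q \<phi> \<nu>0 n0 (X + Z) = updated_ppd M T p q \<phi> \<nu>0 n0 (Y + Z)"
      using sub unfolding ppd_equivalent_def updated_ppd_add by blast
  qed
qed

theorem theorem2:
  fixes M :: "'x measure" and T :: "'t measure"
    and p :: "'t \<Rightarrow> 'x \<Rightarrow> real"
    and q :: "real ^ 'k \<Rightarrow> real \<Rightarrow> 't \<Rightarrow> real"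
    and \<phi> :: "'x \<Rightarrow> real ^ 'k"
    and \<nu>0 :: "real ^ 'k" and n0 :: real and m :: nat
  assumes "distribution_family M T p"
    and "conjugate_prior_family M T p q \<phi>"
    and "n0 > 0"
    and "m \<ge> 2"
  shows "((\<exists>(R :: 'x measure set) S.
             optimal_aggregation M (updated_ppd M T p q \<phi> \<nu>0 n0) m R S) \<longleftrightarrow>
          (\<forall>\<nu> n \<nu>' n'.
             reachable M \<phi> \<nu>0 n0 \<nu> n \<longrightarrow> reachable M \<phi> \<nu>0 n0 \<nu>' n' \<longrightarrow>
             ppd M T p q \<nu> n = ppd M T p q \<nu>' n' \<longrightarrow>
             ppd_equivalent M T p q \<phi> \<nu> n \<nu>' n')) \<and>
         ((\<exists>(R :: 'r set) S.
             optimal_aggregation M (updated_ppd M T p q \<phi> \<nu>0 n0) m R S) \<longrightarrow>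
          (\<exists>(R :: 'x measure set) S.
             optimal_aggregation M (updated_ppd M T p q \<phi> \<nu>0 n0) m R S))"
proof -
  interpret M: sigma_finite_measure M
    using assms(1) by (simp add: distribution_family_def)
  let ?belief = "updated_ppd M T p q \<phi> \<nu>0 n0"
  \<comment> \<open>Samples only raise the count above \<open>n0 > 0\<close>, so every belief is a
    mixture over a genuine density.\<close>
  have "prob_density T (q \<nu> (n0 + real k))" for \<nu> k
    using assms(2,3) by (simp add: conjugate_prior_family_def add_pos_nonneg)
  then have belief: "?belief X \<in> distributions M" for X
    unfolding updated_ppd_def ppd_def by (rule mixture_in_distributions[OF assms(1)])
  have "\<exists>(R :: 'x measure set) S. optimal_aggregation M ?belief m R S"
    if "sum_compatible (space M) ?belief"
    using belief that by (rule M.sum_compatible_imp_optimal_aggregation)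
  moreover have "sum_compatible (space M) ?belief"
    if "optimal_aggregation M ?belief m R S" for R :: "'x measure set" and S
    using that assms(4) by (rule optimal_aggregation_imp_sum_compatible)
  \<comment> \<open>The same argument for reports in \<open>'r\<close>: compatibility does not
    mention the report type, so it carries a mechanism from \<open>'r\<close> over to reports that
    are measures.\<close>
  moreover have "sum_compatible (space M) ?belief"
    if "optimal_aggregation M ?belief m R S" for R :: "'r set" and S
    using that assms(4) by (rule optimal_aggregation_imp_sum_compatible)
  ultimately show ?thesis
    unfolding sum_compatible_updated_ppd_iff[symmetric] by blast
qed

end
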